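(* Let $(\mathcal{A},\cdot)$ be an associative algebra over a field $\mathbb{F}$ and suppose that there exists $u\in\mathcal{A}$ such that $u^{2}=-u$ and $u\cdot x\in\mathcal{A}$ for all $x\in\mathcal{A}$. Then the linear map $R:\mathcal{A}\to\mathcal{A}$ defined by $R(x)=u\cdot x$ satisfies $$R\bigl(R(x)\cdot y+x\cdot R(y)+x\cdot y\bigr)=R(x)\cdot R(y)\quad\text{for all }x,y\in\mathcal{A}.$$ Furthermore, if instead $u\in\mathcal{A}$ satisfies $u^{2}=0$, then $R(x)=u\cdot x$ is a Rota-Baxter operator of weight zero on $\mathcal{A}$.
   Context: Associative algebras are not assumed to be unital or commutative. For a scalar $\lambda$, a linear map $R:\mathcal{A}\to\mathcal{A}$ on an associative algebra is a Rota-Baxter operator of weight $\lambda$ if $R(x)\cdot R(y)=R\bigl(R(x)\cdot y+x\cdot R(y)+\lambda\,x\cdot y\bigr)$ for all $x,y\in\mathcal{A}$. *)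

theory Defs
  imports Complex_Main
begin

(* Class ring is an associative, possibly non-commutative ring without a unit,
   so the algebra is neither unital nor commutative. *)

locale assoc_algebra = vector_space scale
  for scale :: "'f::field \<Rightarrow> 'a::ring \<Rightarrow> 'a"  (infixr \<open>*s\<close> 75) +
  assumes mult_scale_left: "(c *s x) * y = c *s (x * y)"
    and mult_scale_right: "x * (c *s y) = c *s (x * y)"

definition (in assoc_algebra) rota_baxter_operator :: "'f \<Rightarrow> ('a \<Rightarrow> 'a) \<Rightarrow> bool" where
  "rota_baxter_operator w R \<longleftrightarrow>
     Vector_Spaces.linear scale scale R \<and>
     (\<forall>x y. R x * R y = R (R x * y + x * R y + w *s (x * y)))"

end

theory Submission
  imports Defs
begin

text \<open>Both claims are instances, at weight \<open>1\<close> and at weight \<open>0\<close>, of one fact: left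
  multiplication by \<open>u\<close> is a Rota-Baxter operator of weight \<open>w\<close> as soon as \<open>u\<^sup>2 = - w u\<close>.
  Expanding \<open>u (u x y + x u y + w x y)\<close> by associativity gives \<open>u\<^sup>2 x y + u x u y + w u x y\<close>;
  the hypothesis makes the outer two terms cancel, and the middle one is \<open>(u x) (u y)\<close>.\<close>

context assoc_algebra
begin

lemma linear_left_mult: "Vector_Spaces.linear scale scale (\<lambda>x. u * x)"
  by unfold_locales (simp_all add: distrib_left mult_scale_right)

lemma rota_baxter_left_mult:
  assumes "u * u = - (w *s u)"
  shows "rota_baxter_operator w (\<lambda>x. u * x)"
  unfolding rota_baxter_operator_def
proof (intro conjI allI)
  fix x y
  have "u * ((u * x) * y + x * (u * y) + w *s (x * y))
      = (u * u) * (x * y) + (u * x) * (u * y) + w *s (u * (x * y))"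
    by (simp add: distrib_left mult_scale_right mult.assoc)
  also have "(u * u) * (x * y) = - (w *s (u * (x * y)))"
    by (simp add: assms mult_scale_left)
  finally show "(u * x) * (u * y) = u * ((u * x) * y + x * (u * y) + w *s (x * y))"
    by simp
qed (rule linear_left_mult)

end

theorem proposition7p0p5:
  fixes scale :: "'f::field \<Rightarrow> 'a::ring \<Rightarrow> 'a"
    and u :: 'a
    and R :: "'a \<Rightarrow> 'a"
  assumes "assoc_algebra scale"
    and "\<And>x. R x = u * x"
  shows "(u * u = - u \<longrightarrow>
            Vector_Spaces.linear scale scale R \<and>
            (\<forall>x y. R (R x * y + x * R y + x * y) = R x * R y)) \<and>
         (u * u = 0 \<longrightarrow> assoc_algebra.rota_baxter_operator scale 0 R)"
proof -
  interpret assoc_algebra scale by fact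
  have R: "R = (\<lambda>x. u * x)"
    using assms(2) by (rule ext)
  show ?thesis
  proof (intro conjI[of "_ \<longrightarrow> _"] impI)
    assume "u * u = - u"
    then have "rota_baxter_operator 1 R"
      unfolding R by (intro rota_baxter_left_mult) simp
    then show "Vector_Spaces.linear scale scale R \<and>
        (\<forall>x y. R (R x * y + x * R y + x * y) = R x * R y)"
      by (simp add: rota_baxter_operator_def)
  next
    assume "u * u = 0"
    then show "rota_baxter_operator 0 R"
      unfolding R by (intro rota_baxter_left_mult) simp
  qed
qed

end
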